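(* Let $(\mathcal{P},\mathcal{B})$ be an $\mathrm{SRPG}(s,t;\alpha_1,\dots,\alpha_r;\lambda,\mu)$ with $n=|\mathcal{B}|$ blocks, such that $\alpha_i\ge2$ for some $1\le i\le r$, and let $M$ be its incidence matrix. Then the exact number of $6$-cycles in the Tanner graph of the LDPC code $C(M)$ is $$\frac{n\,s(s+1)(\lambda-s+1)}{6}.$$
   Context: A generalized partial geometry of grade $r$, denoted $\mathrm{PG}(s,t;\alpha_1,\dots,\alpha_r)$, is an incidence structure $(\mathcal{P},\mathcal{B})$, with $\mathcal{P}$ a finite non-empty set of points and $\mathcal{B}$ a family of subsets of $\mathcal{P}$ (blocks), incidence being containment, such that: (i) any two distinct points are incident with at most one common block; (ii) each block is incident with exactly $s+1$ points; (iii) each point is incident with exactly $t+1$ blocks; (iv) for any point $P$ and block $B$ with $P\notin B$, there is $\alpha\in\{\alpha_1,\dots,\alpha_r\}$ such that exactly $\alpha$ points of $B$ are joined to $P$ (two points are joined if some block contains both); (v) for each $\alpha\in\{\alpha_1,\dots,\alpha_r\}$ there exist a point $P$ and a block $B$ with $P\notin B$ such that exactly $\alpha$ points of $B$ are joined to $P$. The point graph of $(\mathcal{P},\mathcal{B})$ has vertex set $\mathcal{P}$, two distinct points being adjacent if and only if some block contains both. A $k$-regular graph on $v$ vertices is strongly regular with parameters $(v,k,\lambda,\mu)$ if any two adjacent vertices have exactly $\lambda$ common neighbours and any two distinct non-adjacent vertices have exactly $\mu$ common neighbours. A $\mathrm{PG}(s,t;\alpha_1,\dots,\alpha_r)$ whose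 point graph is strongly regular with parameters $(v,k,\lambda,\mu)$ is denoted $\mathrm{SRPG}(s,t;\alpha_1,\dots,\alpha_r;\lambda,\mu)$; its parameters are $k=s(t+1)$ and $v=\frac{k(k-\lambda-1)}{\mu}+k+1$. The incidence matrix $M$ is the $0/1$ matrix with rows indexed by points and columns by blocks, with entry $1$ exactly when the point lies on the block, and $C(M)$ is the binary linear code with parity-check matrix $M$. The Tanner graph of $C(M)$ is the bipartite graph with vertex set $\mathcal{P}\cup\mathcal{B}$ in which a point and a block are adjacent if and only if the point lies in the block. A $6$-cycle is a cycle subgraph of length $6$ (counted without orientation or starting point). *)

theory Defs
  imports Complex_Main "HOL-Library.Z2"
begin

text \<open>Undirected graphs are pairs of a vertex set and a set of two-element edges.\<close>

type_synonym 'v ugraph = "'v set \<times> 'v set set"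

abbreviation verts :: "'v ugraph \<Rightarrow> 'v set" where
  "verts G \<equiv> fst G"

abbreviation edges :: "'v ugraph \<Rightarrow> 'v set set" where
  "edges G \<equiv> snd G"

definition simple_graph :: "'v ugraph \<Rightarrow> bool" where
  "simple_graph G \<longleftrightarrow> (\<forall>e\<in>edges G. e \<subseteq> verts G \<and> card e = 2)"

definition adjacent :: "'v ugraph \<Rightarrow> 'v \<Rightarrow> 'v \<Rightarrow> bool" where
  "adjacent G x y \<longleftrightarrow> {x, y} \<in> edges G"

definition neighbours :: "'v ugraph \<Rightarrow> 'v \<Rightarrow> 'v set" where
  "neighbours G x = {y \<in> verts G. adjacent G x y}"

definition strongly_regular :: "'v ugraph \<Rightarrow> nat \<Rightarrow> nat \<Rightarrow> nat \<Rightarrow> nat \<Rightarrow> bool" where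
  "strongly_regular G v k l m \<longleftrightarrow>
     simple_graph G \<and> finite (verts G) \<and> card (verts G) = v \<and>
     (\<forall>x\<in>verts G. card (neighbours G x) = k) \<and>
     (\<forall>x\<in>verts G. \<forall>y\<in>verts G. adjacent G x y \<longrightarrow>
        card (neighbours G x \<inter> neighbours G y) = l) \<and>
     (\<forall>x\<in>verts G. \<forall>y\<in>verts G. x \<noteq> y \<and> \<not> adjacent G x y \<longrightarrow>
        card (neighbours G x \<inter> neighbours G y) = m)"

definition subgraph :: "'v ugraph \<Rightarrow> 'v ugraph \<Rightarrow> bool" where
  "subgraph H G \<longleftrightarrow> simple_graph H \<and> verts H \<subseteq> verts G \<and> edges H \<subseteq> edges G"

definition cycle_graph :: "nat \<Rightarrow> 'v ugraph \<Rightarrow> bool" where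
  "cycle_graph m C \<longleftrightarrow> 3 \<le> m \<and>
     (\<exists>xs. distinct xs \<and> length xs = m \<and>
        C = (set xs, {{xs ! i, xs ! (Suc i mod m)} | i. i < m}))"

text \<open>Cycles are counted as subgraphs, hence without orientation or starting point.\<close>

definition cycles :: "nat \<Rightarrow> 'v ugraph \<Rightarrow> 'v ugraph set" where
  "cycles m G = {C. subgraph C G \<and> cycle_graph m C}"

definition joined :: "'a set set \<Rightarrow> 'a \<Rightarrow> 'a \<Rightarrow> bool" where
  "joined \<B> p q \<longleftrightarrow> (\<exists>b\<in>\<B>. p \<in> b \<and> q \<in> b)"

definition point_graph :: "'a set \<Rightarrow> 'a set set \<Rightarrow> 'a ugraph" where
  "point_graph \<P> \<B> =
     (\<P>, {{p, q} | p q. p \<in> \<P> \<and> q \<in> \<P> \<and> p \<noteq> q \<and> joined \<B> p q})"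

text \<open>The parameters \<open>\<alpha>\<^sub>1, \<dots>, \<alpha>\<^sub>r\<close> are the values of a function on \<open>{1..r}\<close>;
  its values outside this range play no role.\<close>

locale generalized_partial_geometry =
  fixes \<P> :: "'a set" and \<B> :: "'a set set"
    and s t r :: nat and \<alpha> :: "nat \<Rightarrow> nat"
  assumes finite_points: "finite \<P>"
    and points_nonempty: "\<P> \<noteq> {}"
    and blocks_subset: "\<And>b. b \<in> \<B> \<Longrightarrow> b \<subseteq> \<P>"
    and at_most_one_block:
      "\<And>p q b b'. p \<in> \<P> \<Longrightarrow> q \<in> \<P> \<Longrightarrow> p \<noteq> q \<Longrightarrow>
         b \<in> \<B> \<Longrightarrow> p \<in> b \<Longrightarrow> q \<in> b \<Longrightarrow> b' \<in> \<B> \<Longrightarrow> p \<in> b' \<Longrightarrow> q \<in> b' \<Longrightarrow> b = b'"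
    and block_size: "\<And>b. b \<in> \<B> \<Longrightarrow> card b = s + 1"
    and point_degree: "\<And>p. p \<in> \<P> \<Longrightarrow> card {b \<in> \<B>. p \<in> b} = t + 1"
    and joined_count:
      "\<And>p b. p \<in> \<P> \<Longrightarrow> b \<in> \<B> \<Longrightarrow> p \<notin> b \<Longrightarrow>
         \<exists>i\<in>{1..r}. card {q \<in> b. joined \<B> p q} = \<alpha> i"
    and joined_count_attained:
      "\<And>i. i \<in> {1..r} \<Longrightarrow>
         \<exists>p\<in>\<P>. \<exists>b\<in>\<B>. p \<notin> b \<and> card {q \<in> b. joined \<B> p q} = \<alpha> i"

text \<open>\<open>l\<close> and \<open>m\<close> are \<open>\<lambda>\<close> and \<open>\<mu>\<close>. The remaining parameters \<open>v\<close> and \<open>k\<close> of the point graph are determined by the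
  geometry, so they are not parameters of the notion.\<close>

locale strongly_regular_partial_geometry =
  generalized_partial_geometry \<P> \<B> s t r \<alpha>
  for \<P> :: "'a set" and \<B> :: "'a set set" and s t r :: nat and \<alpha> :: "nat \<Rightarrow> nat" +
  fixes l m :: nat
  assumes strongly_regular_point_graph:
    "\<exists>v k. strongly_regular (point_graph \<P> \<B>) v k l m"

definition incidence_matrix :: "'a \<Rightarrow> 'a set \<Rightarrow> bit" where
  "incidence_matrix p b = (if p \<in> b then 1 else 0)"

text \<open>The Tanner graph of a binary code depends on the chosen parity-check matrix \<open>H\<close>, here
  given with its sets \<open>R\<close> and \<open>C\<close> of row and column indices. The vertices are taken from a
  sum type to keep rows and columns apart.\<close>

definition tanner_graph :: "'r set \<Rightarrow> 'c set \<Rightarrow> ('r \<Rightarrow> 'c \<Rightarrow> bit) \<Rightarrow> ('r + 'c) ugraph" where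
  "tanner_graph R C H =
     (Inl ` R \<union> Inr ` C, {{Inl i, Inr j} | i j. i \<in> R \<and> j \<in> C \<and> H i j = 1})"

lemma tanner_graph_incidence_matrix:
  "tanner_graph \<P> \<B> incidence_matrix =
     (Inl ` \<P> \<union> Inr ` \<B>, {{Inl p, Inr b} | p b. p \<in> \<P> \<and> b \<in> \<B> \<and> p \<in> b})"
proof -
  have "incidence_matrix p b = 1 \<longleftrightarrow> p \<in> b" for p :: 'a and b
    by (simp add: incidence_matrix_def)
  then show ?thesis by (simp add: tanner_graph_def)
qed

lemma simple_graph_point_graph: "simple_graph (point_graph \<P> \<B>)"
  by (auto simp: simple_graph_def point_graph_def)

lemma simple_graph_tanner_graph: "simple_graph (tanner_graph R C H)"
  by (auto simp: simple_graph_def tanner_graph_def)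

lemma adjacent_point_graph:
  "adjacent (point_graph \<P> \<B>) p q \<longleftrightarrow> p \<in> \<P> \<and> q \<in> \<P> \<and> p \<noteq> q \<and> joined \<B> p q"
  by (auto simp: adjacent_def point_graph_def doubleton_eq_iff joined_def)

end

theory Submission
  imports Defs "HOL-Combinatorics.Multiset_Permutations"
begin

text \<open>A 6-cycle of the Tanner graph alternates between three points and three blocks, and the
  three points are pairwise joined without lying on a common block. Conversely such a triangle of
  points determines its three connecting blocks, hence exactly one 6-cycle. An ordered triangle
  \<open>(p, q, w)\<close> consists of a block \<open>b\<close>, two distinct points \<open>p, q \<in> b\<close>, and a common neighbour \<open>w\<close>
  of \<open>p\<close> and \<open>q\<close> outside \<open>b\<close>. Of the \<open>\<lambda>\<close> common neighbours, \<open>s - 1\<close> lie on \<open>b\<close>.\<close>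

section \<open>Six-cycles of the Tanner graph as alternating hexagons\<close>

definition hexagon :: "'v \<Rightarrow> 'v \<Rightarrow> 'v \<Rightarrow> 'v \<Rightarrow> 'v \<Rightarrow> 'v \<Rightarrow> 'v ugraph" where
  "hexagon a b c d e f =
     ({a, b, c, d, e, f}, {{a, b}, {b, c}, {c, d}, {d, e}, {e, f}, {f, a}})"

text \<open>Moves the starting vertex on by one place, so that a cycle in a bipartite graph can
  always be read from the side of the points.\<close>

lemma hexagon_rotate: "hexagon a b c d e f = hexagon b c d e f a"
  by (simp add: hexagon_def insert_commute)

text \<open>Writing out the six indices turns the indexed edges into explicit ones;
  \<open>Suc 5 mod 6 = 0\<close> yields the closing edge \<open>{f, a}\<close>.\<close>

lemma cycle_graph_6_iff:
  "cycle_graph 6 C \<longleftrightarrow>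
     (\<exists>a b c d e f. distinct [a, b, c, d, e, f] \<and> C = hexagon a b c d e f)"
proof -
  have six: "{g i | i. i < (6::nat)} = {g 0, g 1, g 2, g 3, g 4, g 5}" for g :: "nat \<Rightarrow> 'b"
  proof -
    have "{..<6::nat} = {0, 1, 2, 3, 4, 5}" by auto
    moreover have "{g i | i. i < (6::nat)} = g ` {..<6}" by auto
    ultimately show ?thesis by simp
  qed
  have hex: "(set xs, {{xs ! i, xs ! (Suc i mod 6)} | i. i < 6}) = hexagon a b c d e f"
    if "xs = [a, b, c, d, e, f]" for xs and a b c d e f :: 'a
    unfolding six hexagon_def that by simp
  have list6: "\<exists>a b c d e f. xs = [a, b, c, d, e, f]" if "length xs = 6" for xs :: "'a list"
    using that by (auto simp: eval_nat_numeral length_Suc_conv)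
  show ?thesis
  proof
    assume "cycle_graph 6 C"
    then obtain xs where "distinct xs" "length xs = 6"
      "C = (set xs, {{xs ! i, xs ! (Suc i mod 6)} | i. i < 6})"
      by (auto simp: cycle_graph_def)
    moreover from this list6 obtain a b c d e f where xs: "xs = [a, b, c, d, e, f]" by blast
    ultimately have "distinct [a, b, c, d, e, f]" "C = hexagon a b c d e f"
      using hex[OF xs] by simp_all
    then show "\<exists>a b c d e f. distinct [a, b, c, d, e, f] \<and> C = hexagon a b c d e f"
      by blast
  next
    assume "\<exists>a b c d e f. distinct [a, b, c, d, e, f] \<and> C = hexagon a b c d e f"
    then obtain a b c d e f where "distinct [a, b, c, d, e, f]" "C = hexagon a b c d e f"
      by blast
    then show "cycle_graph 6 C"
      unfolding cycle_graph_def using hex[OF refl, of a b c d e f]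
      by (intro conjI exI[of _ "[a, b, c, d, e, f]"]) simp_all
  qed
qed

text \<open>Every edge joins an \<open>Inl\<close> to an \<open>Inr\<close>, so points and blocks
  alternate around the cycle. This normal form starts at a point; one cycle has several such
  readings, which the existential quantifier leaves open.\<close>

lemma cycles_6_tanner_graph_iff:
  "C \<in> cycles 6 (tanner_graph \<P> \<B> incidence_matrix) \<longleftrightarrow>
     (\<exists>p b q c w d. p \<noteq> q \<and> q \<noteq> w \<and> w \<noteq> p \<and> b \<noteq> c \<and> c \<noteq> d \<and> d \<noteq> b \<and>
        {p, q, w} \<subseteq> \<P> \<and> {b, c, d} \<subseteq> \<B> \<and> {p, q} \<subseteq> b \<and> {q, w} \<subseteq> c \<and> {w, p} \<subseteq> d \<and>
        C = hexagon (Inl p) (Inr b) (Inl q) (Inr c) (Inl w) (Inr d))"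
    (is "?L \<longleftrightarrow> ?R")
proof
  let ?E = "edges (tanner_graph \<P> \<B> incidence_matrix)"
  have edge: "{Inl p, Inr b} \<in> ?E \<longleftrightarrow> p \<in> \<P> \<and> b \<in> \<B> \<and> p \<in> b"
    "{Inr b, Inl p} \<in> ?E \<longleftrightarrow> p \<in> \<P> \<and> b \<in> \<B> \<and> p \<in> b"
    "{Inl p, Inl q} \<notin> ?E" "{Inr b, Inr c} \<notin> ?E" for p q b c
    by (auto simp: tanner_graph_incidence_matrix doubleton_eq_iff)
  \<comment> \<open>With a point in first place, the edges force the kind of each further vertex in
    turn.\<close>
  have start: ?R
    if C: "C = hexagon (Inl p) x2 x3 x4 x5 x6" and dist: "distinct [Inl p, x2, x3, x4, x5, x6]"
      and sub: "edges C \<subseteq> ?E" for p x2 x3 x4 x5 x6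
  proof -
    have e: "{Inl p, x2} \<in> ?E" "{x2, x3} \<in> ?E" "{x3, x4} \<in> ?E" "{x4, x5} \<in> ?E"
      "{x5, x6} \<in> ?E" "{x6, Inl p} \<in> ?E"
      using sub by (auto simp: C hexagon_def)
    obtain b where b: "x2 = Inr b" using e edge by (cases x2) auto
    obtain q where q: "x3 = Inl q" using e edge b by (cases x3) auto
    obtain c where c: "x4 = Inr c" using e edge q by (cases x4) auto
    obtain w where w: "x5 = Inl w" using e edge c by (cases x5) auto
    obtain d where d: "x6 = Inr d" using e edge w by (cases x6) auto
    show ?R
      using C dist e unfolding b q c w d edge
      by (intro exI[of _ p] exI[of _ b] exI[of _ q] exI[of _ c] exI[of _ w] exI[of _ d]) auto
  qed
  assume ?L
  then have sub: "edges C \<subseteq> ?E" and "cycle_graph 6 C"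
    by (auto simp: cycles_def subgraph_def)
  then obtain x1 x2 x3 x4 x5 x6
    where dist: "distinct [x1, x2, x3, x4, x5, x6]" and C: "C = hexagon x1 x2 x3 x4 x5 x6"
    unfolding cycle_graph_6_iff by blast
  show ?R
  proof (cases x1)
    case (Inl p)
    show ?R
      by (rule start[of p x2 x3 x4 x5 x6]) (use C dist sub Inl in simp_all)
  next
    \<comment> \<open>A cycle that begins at a block has a point in second place; rotating by one
      reduces this to \<open>start\<close>.\<close>
    case (Inr b)
    moreover have "{x1, x2} \<in> ?E" using sub by (auto simp: C hexagon_def)
    ultimately obtain p where "x2 = Inl p" using edge by (cases x2) auto
    moreover have "C = hexagon x2 x3 x4 x5 x6 x1"
      using C hexagon_rotate by simp
    ultimately show ?R
      by (intro start[of p x3 x4 x5 x6 x1]) (use dist sub in auto)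
  qed
next
  assume ?R
  then obtain p b q c w d where *: "p \<noteq> q" "q \<noteq> w" "w \<noteq> p" "b \<noteq> c" "c \<noteq> d" "d \<noteq> b"
    "{p, q, w} \<subseteq> \<P>" "{b, c, d} \<subseteq> \<B>" "{p, q} \<subseteq> b" "{q, w} \<subseteq> c" "{w, p} \<subseteq> d"
    "C = hexagon (Inl p) (Inr b) (Inl q) (Inr c) (Inl w) (Inr d)"
    by blast
  have "cycle_graph 6 C"
    unfolding cycle_graph_6_iff
    by (rule exI[of _ "Inl p"], rule exI[of _ "Inr b"], rule exI[of _ "Inl q"],
        rule exI[of _ "Inr c"], rule exI[of _ "Inl w"], rule exI[of _ "Inr d"])
      (use * in auto)
  moreover have "subgraph C (tanner_graph \<P> \<B> incidence_matrix)"
    using * by (auto simp: subgraph_def simple_graph_def hexagon_def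
        tanner_graph_incidence_matrix insert_commute)
  ultimately show ?L by (simp add: cycles_def)
qed

section \<open>Triangles of points correspond to six-cycles\<close>

definition triangles :: "'a set \<Rightarrow> 'a set set \<Rightarrow> 'a set set" where
  "triangles \<P> \<B> = {X. X \<subseteq> \<P> \<and> card X = 3 \<and> (\<forall>p\<in>X. \<forall>q\<in>X. joined \<B> p q) \<and>
     \<not> (\<exists>b\<in>\<B>. X \<subseteq> b)}"

definition triangle_blocks :: "'a set set \<Rightarrow> 'a set \<Rightarrow> 'a set set" where
  "triangle_blocks \<B> X = {b \<in> \<B>. \<exists>p\<in>X. \<exists>q\<in>X. p \<noteq> q \<and> p \<in> b \<and> q \<in> b}"

text \<open>For \<open>X\<close> inside \<open>\<P>\<close>, this is the subgraph of the Tanner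
  graph induced on the points of \<open>X\<close> and the blocks through at least two of them. No
  ordering of \<open>X\<close> is chosen, so the cycle is a function of the set.\<close>

definition triangle_cycle :: "'a set set \<Rightarrow> 'a set \<Rightarrow> ('a + 'a set) ugraph" where
  "triangle_cycle \<B> X = (Inl ` X \<union> Inr ` triangle_blocks \<B> X,
     {{Inl p, Inr b} | p b. p \<in> X \<and> b \<in> triangle_blocks \<B> X \<and> p \<in> b})"

text \<open>The points of \<open>X\<close> are recovered as the \<open>Inl\<close> part of the
  vertex set.\<close>

lemma inj_triangle_cycle: "inj (triangle_cycle \<B>)"
proof (rule injI)
  fix X Y assume "triangle_cycle \<B> X = triangle_cycle \<B> Y"
  then have "Inl -` verts (triangle_cycle \<B> X) = Inl -` verts (triangle_cycle \<B> Y)" by simp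
  moreover have "Inl -` verts (triangle_cycle \<B> Z) = Z" for Z
    by (auto simp: triangle_cycle_def)
  ultimately show "X = Y" by simp
qed

context generalized_partial_geometry
begin

lemma block_eqI:
  assumes "b \<in> \<B>" "c \<in> \<B>" "p \<noteq> q" "p \<in> b" "q \<in> b" "p \<in> c" "q \<in> c"
  shows "b = c"
  using at_most_one_block[of p q b c] blocks_subset assms by blast

lemma finite_block: "b \<in> \<B> \<Longrightarrow> finite b"
  using blocks_subset finite_points finite_subset by blast

lemma finite_blocks: "finite \<B>"
  using blocks_subset finite_points by (meson Pow_iff finite_Pow_iff finite_subset subsetI)

text \<open>If two sides lay on the same block, that block would contain all three points.
  Conversely, a block through all three points would share two points with \<open>b\<close> and two
  with \<open>c\<close>, hence equal both, although \<open>b \<noteq> c\<close>.\<close>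

lemma triangles_3_iff:
  assumes "p \<noteq> q" "q \<noteq> w" "w \<noteq> p"
  shows "{p, q, w} \<in> triangles \<P> \<B> \<longleftrightarrow>
    (\<exists>b c d. {b, c, d} \<subseteq> \<B> \<and> {p, q} \<subseteq> b \<and> {q, w} \<subseteq> c \<and> {w, p} \<subseteq> d \<and>
       b \<noteq> c \<and> c \<noteq> d \<and> d \<noteq> b)" (is "?L \<longleftrightarrow> ?R")
proof
  assume ?L
  then have "joined \<B> p q" "joined \<B> q w" "joined \<B> w p"
    and none: "\<not> (\<exists>b\<in>\<B>. {p, q, w} \<subseteq> b)"
    by (auto simp: triangles_def)
  then obtain b c d where "b \<in> \<B>" "c \<in> \<B>" "d \<in> \<B>" "{p, q} \<subseteq> b" "{q, w} \<subseteq> c" "{w, p} \<subseteq> d"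
    unfolding joined_def by auto
  moreover from this none have "b \<noteq> c" "c \<noteq> d" "d \<noteq> b" by auto
  ultimately show ?R by blast
next
  assume ?R
  then obtain b c d where *: "b \<in> \<B>" "c \<in> \<B>" "d \<in> \<B>" "p \<in> b" "q \<in> b" "q \<in> c" "w \<in> c"
    "w \<in> d" "p \<in> d" "b \<noteq> c"
    by auto
  have "\<not> (\<exists>a\<in>\<B>. {p, q, w} \<subseteq> a)"
  proof
    assume "\<exists>a\<in>\<B>. {p, q, w} \<subseteq> a"
    then obtain a where "a \<in> \<B>" "p \<in> a" "q \<in> a" "w \<in> a" by auto
    then have "a = b" "a = c" using * assms block_eqI by blast+
    with \<open>b \<noteq> c\<close> show False by simp
  qed
  moreover have "{p, q, w} \<subseteq> \<P>" using * blocks_subset by blast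
  moreover have "\<forall>x\<in>{p, q, w}. \<forall>y\<in>{p, q, w}. joined \<B> x y" using * by (auto simp: joined_def)
  ultimately show ?L using assms by (auto simp: triangles_def)
qed

text \<open>Any block through two of the points is the side joining them, so \<open>b\<close>,
  \<open>c\<close>, \<open>d\<close> are all the blocks involved. Each misses the opposite point,
  which leaves exactly the six incidences of the hexagon.\<close>

lemma triangle_cycle_eq_hexagon:
  assumes dist: "p \<noteq> q" "q \<noteq> w" "w \<noteq> p" "b \<noteq> c" "c \<noteq> d" "d \<noteq> b"
    and sub: "{b, c, d} \<subseteq> \<B>" "{p, q} \<subseteq> b" "{q, w} \<subseteq> c" "{w, p} \<subseteq> d"
  shows "triangle_cycle \<B> {p, q, w} = hexagon (Inl p) (Inr b) (Inl q) (Inr c) (Inl w) (Inr d)"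
proof -
  have B: "b \<in> \<B>" "c \<in> \<B>" "d \<in> \<B>" and i: "p \<in> b" "q \<in> b" "q \<in> c" "w \<in> c" "w \<in> d" "p \<in> d"
    using sub by auto
  \<comment> \<open>A side containing the opposite point would share two points with another side
    and coincide with it.\<close>
  have n: "w \<notin> b" "p \<notin> c" "q \<notin> d"
    using block_eqI[OF B(1,2)] block_eqI[OF B(2,3)] block_eqI[OF B(3,1)] i dist by blast+
  have "a \<in> {b, c, d}" if "a \<in> \<B>" "x \<in> {p, q, w}" "y \<in> {p, q, w}" "x \<noteq> y" "x \<in> a" "y \<in> a"
    for a x y
    using that(2-6) block_eqI[OF that(1) B(1)] block_eqI[OF that(1) B(2)]
      block_eqI[OF that(1) B(3)] i by blast
  then have "triangle_blocks \<B> {p, q, w} \<subseteq> {b, c, d}"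
    unfolding triangle_blocks_def by blast
  moreover have "a \<in> triangle_blocks \<B> {p, q, w}"
    if "a \<in> \<B>" "x \<in> {p, q, w}" "y \<in> {p, q, w}" "x \<noteq> y" "x \<in> a" "y \<in> a" for a x y
    using that unfolding triangle_blocks_def by blast
  from this[OF B(1), of p q] this[OF B(2), of q w] this[OF B(3), of w p]
  have "{b, c, d} \<subseteq> triangle_blocks \<B> {p, q, w}"
    using i dist by simp
  ultimately have "triangle_blocks \<B> {p, q, w} = {b, c, d}" by simp
  moreover have "{{Inl x, Inr y} | x y. x \<in> {p, q, w} \<and> y \<in> {b, c, d} \<and> x \<in> y}
      = (\<lambda>(x, y). {Inl x, Inr y}) ` {(p, b), (q, b), (q, c), (w, c), (w, d), (p, d)}"
  proof -
    have "{(x, y). x \<in> {p, q, w} \<and> y \<in> {b, c, d} \<and> x \<in> y}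
        = {(p, b), (q, b), (q, c), (w, c), (w, d), (p, d)}"
      using n i by auto
    then show ?thesis by (subst (asm) eq_commute) auto
  qed
  ultimately have "edges (triangle_cycle \<B> {p, q, w})
      = edges (hexagon (Inl p) (Inr b) (Inl q) (Inr c) (Inl w) (Inr d))"
    \<comment> \<open>This instance of \<open>insert_commute\<close> applies only to two-element
      sets with a block in front: it puts the point of each edge first and leaves the order of the
      edges alone.\<close>
    by (simp add: triangle_cycle_def hexagon_def insert_commute[of "Inr _" "Inl _" "{}"])
  moreover have "verts (triangle_cycle \<B> {p, q, w})
      = verts (hexagon (Inl p) (Inr b) (Inl q) (Inr c) (Inl w) (Inr d))"
    using \<open>triangle_blocks \<B> {p, q, w} = {b, c, d}\<close>
    by (simp add: triangle_cycle_def hexagon_def insert_commute)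
  ultimately show ?thesis by (rule prod_eqI[rotated])
qed

text \<open>The three sides of a triangle close up to a hexagon, and the three points of a hexagon
  form a triangle from which \<open>triangle_cycle\<close> rebuilds that hexagon.\<close>

lemma bij_betw_triangle_cycle:
  "bij_betw (triangle_cycle \<B>) (triangles \<P> \<B>) (cycles 6 (tanner_graph \<P> \<B> incidence_matrix))"
proof (rule bij_betw_imageI)
  show "inj_on (triangle_cycle \<B>) (triangles \<P> \<B>)"
    using inj_triangle_cycle inj_on_subset by blast
  show "triangle_cycle \<B> ` triangles \<P> \<B> = cycles 6 (tanner_graph \<P> \<B> incidence_matrix)"
  proof (intro equalityI subsetI)
    fix C assume "C \<in> triangle_cycle \<B> ` triangles \<P> \<B>"
    then obtain X where X: "X \<in> triangles \<P> \<B>" and C: "C = triangle_cycle \<B> X" by blast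
    then have "card X = 3" and "X \<subseteq> \<P>" by (auto simp: triangles_def)
    then obtain p q w where pqw: "X = {p, q, w}" "p \<noteq> q" "q \<noteq> w" "w \<noteq> p"
      by (auto simp: card_3_iff)
    with X triangles_3_iff[of p q w]
    obtain b c d where "{b, c, d} \<subseteq> \<B>" "{p, q} \<subseteq> b" "{q, w} \<subseteq> c" "{w, p} \<subseteq> d"
      "b \<noteq> c" "c \<noteq> d" "d \<noteq> b"
      by metis
    moreover from this have "C = hexagon (Inl p) (Inr b) (Inl q) (Inr c) (Inl w) (Inr d)"
      unfolding C pqw(1) using pqw by (intro triangle_cycle_eq_hexagon)
    ultimately show "C \<in> cycles 6 (tanner_graph \<P> \<B> incidence_matrix)"
      unfolding cycles_6_tanner_graph_iff using pqw \<open>X \<subseteq> \<P>\<close>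
      by (intro exI[of _ p] exI[of _ b] exI[of _ q] exI[of _ c] exI[of _ w] exI[of _ d]) simp
  next
    fix C assume "C \<in> cycles 6 (tanner_graph \<P> \<B> incidence_matrix)"
    then obtain p b q c w d where *: "p \<noteq> q" "q \<noteq> w" "w \<noteq> p" "b \<noteq> c" "c \<noteq> d" "d \<noteq> b"
      "{b, c, d} \<subseteq> \<B>" "{p, q} \<subseteq> b" "{q, w} \<subseteq> c" "{w, p} \<subseteq> d"
      "C = hexagon (Inl p) (Inr b) (Inl q) (Inr c) (Inl w) (Inr d)"
      unfolding cycles_6_tanner_graph_iff by blast
    then have "{p, q, w} \<in> triangles \<P> \<B>" using triangles_3_iff[of p q w] by metis
    moreover have "C = triangle_cycle \<B> {p, q, w}"
      unfolding *(11) using *(1-10) by (intro triangle_cycle_eq_hexagon[symmetric])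
    ultimately show "C \<in> triangle_cycle \<B> ` triangles \<P> \<B>" by blast
  qed
qed

section \<open>Ordered triangles and their flags\<close>

lemma card_triangle_orderings:
  "card (\<Union>X\<in>triangles \<P> \<B>. permutations_of_set X) = 6 * card (triangles \<P> \<B>)"
proof -
  have fin: "finite X" if "X \<in> triangles \<P> \<B>" for X
    using that finite_points finite_subset by (auto simp: triangles_def)
  have "triangles \<P> \<B> \<subseteq> Pow \<P>" by (auto simp: triangles_def)
  then have "finite (triangles \<P> \<B>)" using finite_points finite_subset by blast
  \<comment> \<open>Orderings of different triangles are different, because a list determines its
    set.\<close>
  then have "card (\<Union>X\<in>triangles \<P> \<B>. permutations_of_set X)
      = (\<Sum>X\<in>triangles \<P> \<B>. card (permutations_of_set X))"
    by (intro card_UN_disjoint ballI impI) (simp, simp, auto dest: permutations_of_setD)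
  also have "\<dots> = (\<Sum>X\<in>triangles \<P> \<B>. 6)"
  proof (intro sum.cong refl)
    fix X assume X: "X \<in> triangles \<P> \<B>"
    then have "card X = 3" by (simp add: triangles_def)
    with fin[OF X] show "card (permutations_of_set X) = 6" by (simp add: fact_numeral)
  qed
  finally show ?thesis by simp
qed

text \<open>The block \<open>b\<close> is determined by \<open>p\<close> and \<open>q\<close>.
  Carrying it along makes the set a nested \<open>SIGMA\<close>, whose cardinality is an iterated
  sum that starts over the blocks.\<close>

definition flagged_triangles :: "('a set \<times> 'a \<times> 'a \<times> 'a) set" where
  "flagged_triangles = (SIGMA b:\<B>. SIGMA p:b. SIGMA q:b - {p}.
     neighbours (point_graph \<P> \<B>) p \<inter> neighbours (point_graph \<P> \<B>) q - b)"

lemma neighbours_point_graph: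
  "neighbours (point_graph \<P> \<B>) p = {q. p \<in> \<P> \<and> q \<in> \<P> \<and> p \<noteq> q \<and> joined \<B> p q}"
  by (auto simp: neighbours_def adjacent_point_graph) (auto simp: point_graph_def)

text \<open>Injectivity holds because two distinct points lie on at most one block. The condition
  that \<open>w\<close> is off \<open>b\<close> corresponds to the three points not being on a
  common block.\<close>

lemma bij_betw_flagged_triangles:
  "bij_betw (\<lambda>(b, p, q, w). [p, q, w]) flagged_triangles
     (\<Union>X\<in>triangles \<P> \<B>. permutations_of_set X)"
proof (rule bij_betw_imageI)
  show "inj_on (\<lambda>(b, p, q, w). [p, q, w]) flagged_triangles"
    using block_eqI by (auto simp: inj_on_def flagged_triangles_def)
  show "(\<lambda>(b, p, q, w). [p, q, w]) ` flagged_triangles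
      = (\<Union>X\<in>triangles \<P> \<B>. permutations_of_set X)"
  proof (intro equalityI subsetI)
    fix xs assume "xs \<in> (\<lambda>(b, p, q, w). [p, q, w]) ` flagged_triangles"
    then obtain b p q w where xs: "xs = [p, q, w]" and b: "b \<in> \<B>" "p \<in> b" "q \<in> b" "p \<noteq> q" "w \<notin> b"
      and "p \<noteq> w" "q \<noteq> w" "joined \<B> p w" "joined \<B> q w"
      by (auto simp: flagged_triangles_def neighbours_point_graph)
    then obtain c d where cd: "c \<in> \<B>" "d \<in> \<B>" "q \<in> c" "w \<in> c" "p \<in> d" "w \<in> d"
      by (auto simp: joined_def)
    \<comment> \<open>A common block of the sides at \<open>w\<close> would contain \<open>p\<close>
      and \<open>q\<close>, so it would be \<open>b\<close>, which misses \<open>w\<close>.\<close>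
    have "c \<noteq> d"
    proof
      assume "c = d"
      then have "b = c" using block_eqI[of b c p q] b cd by blast
      with \<open>w \<notin> b\<close> \<open>w \<in> c\<close> show False by simp
    qed
    moreover have "b \<noteq> c" "d \<noteq> b" using b cd by auto
    ultimately have "{p, q, w} \<in> triangles \<P> \<B>"
      using triangles_3_iff[of p q w] b cd \<open>p \<noteq> w\<close> \<open>q \<noteq> w\<close> by blast
    moreover have "xs \<in> permutations_of_set {p, q, w}"
      using xs b \<open>p \<noteq> w\<close> \<open>q \<noteq> w\<close> by (auto simp: permutations_of_set_def)
    ultimately show "xs \<in> (\<Union>X\<in>triangles \<P> \<B>. permutations_of_set X)" by blast
  next
    fix xs assume "xs \<in> (\<Union>X\<in>triangles \<P> \<B>. permutations_of_set X)"
    then have xs: "set xs \<in> triangles \<P> \<B>" "distinct xs"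
      by (auto simp: permutations_of_set_def)
    then have "length xs = 3" by (simp add: triangles_def distinct_card)
    then obtain p q w where pqw: "xs = [p, q, w]"
      by (auto simp: eval_nat_numeral length_Suc_conv)
    with xs have "{p, q, w} \<in> triangles \<P> \<B>" and dist: "p \<noteq> q" "q \<noteq> w" "w \<noteq> p" by auto
    then have T: "{p, q, w} \<subseteq> \<P>" "joined \<B> p q" "joined \<B> p w" "joined \<B> q w"
      "\<And>b. b \<in> \<B> \<Longrightarrow> \<not> {p, q, w} \<subseteq> b"
      by (auto simp: triangles_def)
    then obtain b where "b \<in> \<B>" "p \<in> b" "q \<in> b" by (auto simp: joined_def)
    with T dist have "(b, p, q, w) \<in> flagged_triangles"
      by (auto simp: flagged_triangles_def neighbours_point_graph)
    then show "xs \<in> (\<lambda>(b, p, q, w). [p, q, w]) ` flagged_triangles"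
      unfolding pqw by force
  qed
qed

end

section \<open>Counting by strong regularity\<close>

context strongly_regular_partial_geometry
begin

text \<open>The block itself joins \<open>p\<close> and \<open>q\<close> to each of its other
  \<open>s - 1\<close> points, so the remaining \<open>l - (s - 1)\<close> common neighbours are off
  \<open>b\<close>. The additive form avoids truncated subtraction.\<close>

lemma card_common_neighbours_off_block:
  assumes "b \<in> \<B>" "p \<in> b" "q \<in> b" "p \<noteq> q"
  shows "card (neighbours (point_graph \<P> \<B>) p \<inter> neighbours (point_graph \<P> \<B>) q - b) + s = l + 1"
proof -
  let ?N = "neighbours (point_graph \<P> \<B>) p \<inter> neighbours (point_graph \<P> \<B>) q"
  have adj: "adjacent (point_graph \<P> \<B>) p q" "p \<in> verts (point_graph \<P> \<B>)"
    "q \<in> verts (point_graph \<P> \<B>)"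
    using assms blocks_subset unfolding adjacent_point_graph by (auto simp: joined_def point_graph_def)
  then have "card ?N = l"
    using strongly_regular_point_graph unfolding strongly_regular_def by blast
  moreover have "?N \<inter> b = b - {p, q}"
    using assms blocks_subset by (auto simp: neighbours_point_graph joined_def)
  moreover have "card {p, q} + card (b - {p, q}) = s + 1"
    using card_Un_disjoint[of "{p, q}" "b - {p, q}"] assms finite_block block_size[of b]
    by (simp add: insert_absorb)
  moreover have "finite ?N"
    using finite_points by (auto simp: neighbours_point_graph)
  ultimately show ?thesis
    using card_Int_Diff[of ?N b] assms(4) by simp
qed

text \<open>Over the naturals \<open>l - s + 1\<close> would be 1 instead of 0 for
  \<open>l = s - 1\<close>, where all common neighbours of two points of a block lie on it; hence
  the reals.\<close>

lemma card_flagged_triangles: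
  "real (card flagged_triangles) = real (card \<B>) * real s * (real s + 1) * (real l - real s + 1)"
proof -
  let ?N = "\<lambda>b p q. neighbours (point_graph \<P> \<B>) p \<inter> neighbours (point_graph \<P> \<B>) q - b"
  have fin: "finite (?N b p q)" for b p q
    using finite_points by (auto simp: neighbours_point_graph)
  have "card flagged_triangles = (\<Sum>b\<in>\<B>. \<Sum>p\<in>b. \<Sum>q\<in>b - {p}. card (?N b p q))"
    unfolding flagged_triangles_def using fin finite_blocks finite_block by simp
  then have "real (card flagged_triangles) = (\<Sum>b\<in>\<B>. \<Sum>p\<in>b. \<Sum>q\<in>b - {p}. real (card (?N b p q)))"
    by simp
  also have "\<dots> = (\<Sum>b\<in>\<B>. \<Sum>p\<in>b. \<Sum>q\<in>b - {p}. real l - real s + 1)"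
  proof (intro sum.cong refl)
    fix b p q assume "b \<in> \<B>" "p \<in> b" "q \<in> b - {p}"
    then have "card (?N b p q) + s = l + 1"
      using card_common_neighbours_off_block by blast
    then show "real (card (?N b p q)) = real l - real s + 1" by linarith
  qed
  \<comment> \<open>The factor \<open>s\<close> counts the choices of \<open>q\<close> in
    \<open>b - {p}\<close>. For \<open>s = 0\<close> the innermost sum is empty and the factor
    vanishes as well.\<close>
  also have "\<dots> = (\<Sum>b\<in>\<B>. \<Sum>p\<in>b. real s * (real l - real s + 1))"
    using block_size finite_block by (intro sum.cong refl) simp
  also have "\<dots> = (\<Sum>b\<in>\<B>. (real s + 1) * (real s * (real l - real s + 1)))"
    using block_size by (intro sum.cong refl) simp
  finally show ?thesis by simp
qed

end

theorem theorem4p5: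
  fixes \<P> :: "'a set" and \<B> :: "'a set set"
    and s t r l m n :: nat and \<alpha> :: "nat \<Rightarrow> nat"
    and M :: "'a \<Rightarrow> 'a set \<Rightarrow> bit"
  assumes "strongly_regular_partial_geometry \<P> \<B> s t r \<alpha> l m"
    and "n = card \<B>"
    and "\<exists>i. 1 \<le> i \<and> i \<le> r \<and> \<alpha> i \<ge> 2"
    and "M = incidence_matrix"
  shows "real (card (cycles 6 (tanner_graph \<P> \<B> M)))
       = real n * real s * (real s + 1) * (real l - real s + 1) / 6"
proof -
  interpret strongly_regular_partial_geometry \<P> \<B> s t r \<alpha> l m by fact
  \<comment> \<open>Each triangle yields one flagged triangle for each of its six orderings, which
    is the source of the denominator.\<close>
  have "card flagged_triangles = 6 * card (triangles \<P> \<B>)"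
    using bij_betw_same_card[OF bij_betw_flagged_triangles] card_triangle_orderings by simp
  also have "card (triangles \<P> \<B>) = card (cycles 6 (tanner_graph \<P> \<B> M))"
    using bij_betw_same_card[OF bij_betw_triangle_cycle] \<open>M = incidence_matrix\<close> by simp
  finally show ?thesis
    using card_flagged_triangles \<open>n = card \<B>\<close> by simp
qed

end
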